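(* Let $(L,[-,-])$ be a Leibniz algebra over a field $\mathbb{K}$, let $\lambda\in\mathbb{K}$, and let $T(L)=(L,\{-,-,-\})$ with $\{x,y,z\}=[x,[y,z]]$ be the associated ternary Leibniz algebra. If $R:L\to L$ is a Rota-Baxter operator of weight $\lambda$ (respectively $N:L\to L$ is a Nijenhuis operator) on $(L,[-,-])$, then $R$ is a Rota-Baxter operator of weight $\lambda$ (respectively $N$ is a Nijenhuis operator) on the ternary Leibniz algebra $T(L)$. Moreover, let $[-,-]_1$ be another Leibniz bracket on $L$, compatible with $[-,-]$ and such that the ternary Leibniz algebras associated with $(L,[-,-])$ and $(L,[-,-]_1)$ are compatible. If $R$ (respectively $N$) is also a Rota-Baxter operator of weight $\lambda$ (respectively a Nijenhuis operator) on $(L,[-,-]_1)$, then $R$ (respectively $N$) is a Rota-Baxter operator of weight $\lambda$ (respectively a Nijenhuis operator) on the compatible ternary Leibniz algebra $(L,\{-,-,-\},\{-,-,-\}_1)$, where $\{x,y,z\}_1=[x,[y,z]_1]_1$.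
   Context: A Leibniz algebra is a vector space with a bilinear bracket satisfying $[[x,y],z]=[x,[y,z]]+[[x,z],y]$. Two Leibniz brackets on $L$ are compatible if every linear combination of them is a Leibniz bracket. A ternary Leibniz algebra is a vector space with a trilinear bracket satisfying $\{\{x,y,z\},t,u\}=\{x,y,\{z,t,u\}\}+\{x,\{y,t,u\},z\}+\{\{x,t,u\},y,z\}$; $T(L)$ is always one. Two ternary Leibniz brackets $\{\cdot\}_1,\{\cdot\}_2$ on $L$ are compatible (and then form a compatible ternary Leibniz algebra) if for all $x,y,z,t,u$ \begin{align*} \{\{x,y,z\}_1,t,u\}_2+\{\{x,y,z\}_2,t,u\}_1&=\{x,y,\{z,t,u\}_1\}_2+\{x,y,\{z,t,u\}_2\}_1+\{x,\{y,t,u\}_1,z\}_2\\ &\quad+\{x,\{y,t,u\}_2,z\}_1+\{\{x,t,u\}_1,y,z\}_2+\{\{x,t,u\}_2,y,z\}_1. \end{align*} Rota-Baxter operator of weight $\lambda$: on a Leibniz algebra, a linear map $R$ with $[R(x),R(y)]=R([R(x),y]+[x,R(y)]+\lambda[x,y])$; on a ternary Leibniz algebra, a linear map $R$ with \begin{align*} \{R(x),R(y),R(z)\}=R\big(&\{R(x),R(y),z\}+\{R(x),y,R(z)\}+\{x,R(y),R(z)\}\\ &+\lambda\{R(x),y,z\}+\lambda\{x,R(y),z\}+\lambda\{x,y,R(z)\}+\lambda^2\{x,y,z\}\big). \end{align*} Nijenhuis operator: on a Leibniz algebra, a linear map $N$ with $[N(x),N(y)]=N([N(x),y]+[x,N(y)]-N([x,y]))$;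 on a ternary Leibniz algebra, a linear map $N$ with \begin{align*} \{N(x),N(y),N(z)\}&=N\big(\{N(x),N(y),z\}+\{N(x),y,N(z)\}+\{x,N(y),N(z)\}\big)\\ &\quad-N^2\big(\{N(x),y,z\}+\{x,N(y),z\}+\{x,y,N(z)\}\big)+N^3(\{x,y,z\}). \end{align*} All identities are for all $x,y,z\in L$. A Rota-Baxter operator of weight $\lambda$ (respectively Nijenhuis operator) on a compatible ternary Leibniz algebra is a linear map that is one for both brackets. *)

theory Defs
  imports "HOL.Vector_Spaces"
begin

text \<open>
  All structures are carried by a whole type \<open>'v\<close>, which is a vector space over the arbitrary field
  \<open>'k\<close> by means of the scalar multiplication \<open>scale\<close>.
\<close>

locale leibniz_algebra = vector_space scale
  for scale :: "'k::field \<Rightarrow> 'v::ab_group_add \<Rightarrow> 'v" +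
  fixes br :: "'v \<Rightarrow> 'v \<Rightarrow> 'v"
  assumes linear_left: "Vector_Spaces.linear scale scale (\<lambda>x. br x y)"
    and linear_right: "Vector_Spaces.linear scale scale (\<lambda>y. br x y)"
    and leibniz: "br (br x y) z = br x (br y z) + br (br x z) y"

locale compatible_leibniz_algebra =
  A: leibniz_algebra scale br\<^sub>1 + B: leibniz_algebra scale br\<^sub>2
  for scale :: "'k::field \<Rightarrow> 'v::ab_group_add \<Rightarrow> 'v" and br\<^sub>1 br\<^sub>2 +
  assumes compatible:
    "leibniz_algebra scale (\<lambda>x y. scale a (br\<^sub>1 x y) + scale b (br\<^sub>2 x y))"

locale ternary_leibniz_algebra = vector_space scale
  for scale :: "'k::field \<Rightarrow> 'v::ab_group_add \<Rightarrow> 'v" +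
  fixes t :: "'v \<Rightarrow> 'v \<Rightarrow> 'v \<Rightarrow> 'v"
  assumes linear_1: "Vector_Spaces.linear scale scale (\<lambda>x. t x y z)"
    and linear_2: "Vector_Spaces.linear scale scale (\<lambda>y. t x y z)"
    and linear_3: "Vector_Spaces.linear scale scale (\<lambda>z. t x y z)"
    and ternary_leibniz:
      "t (t x y z) u v = t x y (t z u v) + t x (t y u v) z + t (t x u v) y z"

locale compatible_ternary_leibniz_algebra =
  A: ternary_leibniz_algebra scale t\<^sub>1 + B: ternary_leibniz_algebra scale t\<^sub>2
  for scale :: "'k::field \<Rightarrow> 'v::ab_group_add \<Rightarrow> 'v" and t\<^sub>1 t\<^sub>2 +
  assumes compatible:
    "t\<^sub>2 (t\<^sub>1 x y z) u v + t\<^sub>1 (t\<^sub>2 x y z) u v =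
       t\<^sub>2 x y (t\<^sub>1 z u v) + t\<^sub>1 x y (t\<^sub>2 z u v) +
       t\<^sub>2 x (t\<^sub>1 y u v) z + t\<^sub>1 x (t\<^sub>2 y u v) z +
       t\<^sub>2 (t\<^sub>1 x u v) y z + t\<^sub>1 (t\<^sub>2 x u v) y z"

definition assoc_ternary :: "('v \<Rightarrow> 'v \<Rightarrow> 'v) \<Rightarrow> 'v \<Rightarrow> 'v \<Rightarrow> 'v \<Rightarrow> 'v" where
  "assoc_ternary br x y z = br x (br y z)"

text \<open>
  Each operator predicate below contains the statement that the bracket it refers to is a bracket
  of the relevant kind; an operator on a structure is thus never asserted for a non-structure.
\<close>

locale rota_baxter_operator = leibniz_algebra scale br
  for scale :: "'k::field \<Rightarrow> 'v::ab_group_add \<Rightarrow> 'v" and br +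
  fixes lam :: 'k and R :: "'v \<Rightarrow> 'v"
  assumes linear: "Vector_Spaces.linear scale scale R"
    and rota_baxter: "br (R x) (R y) = R (br (R x) y + br x (R y) + scale lam (br x y))"

locale nijenhuis_operator = leibniz_algebra scale br
  for scale :: "'k::field \<Rightarrow> 'v::ab_group_add \<Rightarrow> 'v" and br +
  fixes N :: "'v \<Rightarrow> 'v"
  assumes linear: "Vector_Spaces.linear scale scale N"
    and nijenhuis: "br (N x) (N y) = N (br (N x) y + br x (N y) - N (br x y))"

locale ternary_rota_baxter_operator = ternary_leibniz_algebra scale t
  for scale :: "'k::field \<Rightarrow> 'v::ab_group_add \<Rightarrow> 'v" and t +
  fixes lam :: 'k and R :: "'v \<Rightarrow> 'v"
  assumes linear: "Vector_Spaces.linear scale scale R"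
    and rota_baxter:
      "t (R x) (R y) (R z) =
         R (t (R x) (R y) z + t (R x) y (R z) + t x (R y) (R z)
            + scale lam (t (R x) y z) + scale lam (t x (R y) z) + scale lam (t x y (R z))
            + scale (lam ^ 2) (t x y z))"

locale ternary_nijenhuis_operator = ternary_leibniz_algebra scale t
  for scale :: "'k::field \<Rightarrow> 'v::ab_group_add \<Rightarrow> 'v" and t +
  fixes N :: "'v \<Rightarrow> 'v"
  assumes linear: "Vector_Spaces.linear scale scale N"
    and nijenhuis:
      "t (N x) (N y) (N z) =
         N (t (N x) (N y) z + t (N x) y (N z) + t x (N y) (N z))
         - N (N (t (N x) y z + t x (N y) z + t x y (N z)))
         + N (N (N (t x y z)))"

locale compatible_ternary_rota_baxter_operator =
  compatible_ternary_leibniz_algebra scale t\<^sub>1 t\<^sub>2 +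
  A: ternary_rota_baxter_operator scale t\<^sub>1 lam R +
  B: ternary_rota_baxter_operator scale t\<^sub>2 lam R
  for scale :: "'k::field \<Rightarrow> 'v::ab_group_add \<Rightarrow> 'v" and t\<^sub>1 t\<^sub>2 lam R

locale compatible_ternary_nijenhuis_operator =
  compatible_ternary_leibniz_algebra scale t\<^sub>1 t\<^sub>2 +
  A: ternary_nijenhuis_operator scale t\<^sub>1 N +
  B: ternary_nijenhuis_operator scale t\<^sub>2 N
  for scale :: "'k::field \<Rightarrow> 'v::ab_group_add \<Rightarrow> 'v" and t\<^sub>1 t\<^sub>2 N

end

theory Submission
  imports Defs
begin

text \<open>
  The ternary bracket is the binary bracket iterated once, \<open>{x,y,z} = [x,[y,z]]\<close>, so each
  binary identity can be applied twice. Write the binary condition on an operator \<open>P\<close> as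
  \<open>[P x, P y] = P (x * y)\<close>, where \<open>x * y\<close> is the deformed product
  \<open>[R x, y] + [x, R y] + \<lambda> [x, y]\<close> for a Rota-Baxter operator and
  \<open>[N x, y] + [x, N y] - N [x, y]\<close> for a Nijenhuis operator. Then
  \<open>{P x, P y, P z} = [P x, P (y * z)] = P (x * (y * z))\<close>, and \<open>x * (y * z)\<close> contains
  \<open>[x, P (y * z)]\<close>, which is \<open>[x, [P y, P z]]\<close>. Expanding the rest by bilinearity gives
  the ternary Rota-Baxter identity at once. In the Nijenhuis case the expansion also produces
  \<open>[N x, N [y, z]]\<close>, which needs the binary identity a third time, for the pair
  \<open>x\<close>, \<open>[y, z]\<close>; the two terms \<open>N (N [x, N [y, z]])\<close> that arise then cancel.

  The compatible version asks for the ternary operator identity for each of the two brackets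
  separately, so it follows from the single-bracket version applied to each bracket.
\<close>

context leibniz_algebra
begin

lemmas bracket_linear_right_simps =
  linear_right[THEN Vector_Spaces.linear.axioms(3), THEN module_hom.add]
  linear_right[THEN Vector_Spaces.linear.axioms(3), THEN module_hom.diff]
  linear_right[THEN Vector_Spaces.linear.axioms(3), THEN module_hom.scale]

text \<open>
  The Leibniz identity says that right bracketing with a fixed \<open>w\<close> is a derivation. The ternary
  identity is this derivation property for \<open>w = [u,v]\<close>, used for \<open>[x,[y,z]]\<close> and then for
  the inner bracket \<open>[y,z]\<close>.
\<close>

lemma ternary_leibniz_algebra_assoc_ternary:
  "ternary_leibniz_algebra scale (assoc_ternary br)"
proof (intro ternary_leibniz_algebra.intro ternary_leibniz_algebra_axioms.intro)
  show "vector_space scale"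
    by (rule vector_space_axioms)
next
  fix x y z u v
  show "Vector_Spaces.linear scale scale (\<lambda>x. assoc_ternary br x y z)"
    unfolding assoc_ternary_def by (rule linear_left)
  show "Vector_Spaces.linear scale scale (\<lambda>y. assoc_ternary br x y z)"
    using Vector_Spaces.linear_compose[OF linear_left linear_right]
    by (simp add: assoc_ternary_def o_def)
  show "Vector_Spaces.linear scale scale (\<lambda>z. assoc_ternary br x y z)"
    using Vector_Spaces.linear_compose[OF linear_right linear_right]
    by (simp add: assoc_ternary_def o_def)
  have "br (br x (br y z)) (br u v)
      = br x (br (br y z) (br u v)) + br (br x (br u v)) (br y z)"
    by (rule leibniz)
  also have "br (br y z) (br u v) = br y (br z (br u v)) + br (br y (br u v)) z"
    by (rule leibniz)
  finally show "assoc_ternary br (assoc_ternary br x y z) u v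
      = assoc_ternary br x y (assoc_ternary br z u v)
        + assoc_ternary br x (assoc_ternary br y u v) z
        + assoc_ternary br (assoc_ternary br x u v) y z"
    by (simp add: assoc_ternary_def bracket_linear_right_simps)
qed

end

lemma (in rota_baxter_operator) ternary_rota_baxter_operator_assoc_ternary:
  "ternary_rota_baxter_operator scale (assoc_ternary br) lam R"
proof (intro ternary_rota_baxter_operator.intro ternary_rota_baxter_operator_axioms.intro)
  show "ternary_leibniz_algebra scale (assoc_ternary br)"
    by (rule ternary_leibniz_algebra_assoc_ternary)
  show "Vector_Spaces.linear scale scale R"
    by (rule linear)
  fix x y z
  define p where "p = br (R y) z + br y (R z) + scale lam (br y z)"
  have Rp: "br (R y) (R z) = R p"
    unfolding p_def by (rule rota_baxter)
  have "br (R x) (br (R y) (R z)) = R (br (R x) p + br x (br (R y) (R z)) + scale lam (br x p))"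
    unfolding Rp by (rule rota_baxter)
  then show "assoc_ternary br (R x) (R y) (R z) =
      R (assoc_ternary br (R x) (R y) z + assoc_ternary br (R x) y (R z)
         + assoc_ternary br x (R y) (R z)
         + scale lam (assoc_ternary br (R x) y z) + scale lam (assoc_ternary br x (R y) z)
         + scale lam (assoc_ternary br x y (R z))
         + scale (lam ^ 2) (assoc_ternary br x y z))"
    by (simp add: assoc_ternary_def p_def bracket_linear_right_simps scale_right_distrib
        power2_eq_square ac_simps)
qed

lemma (in nijenhuis_operator) ternary_nijenhuis_operator_assoc_ternary:
  "ternary_nijenhuis_operator scale (assoc_ternary br) N"
proof -
  interpret N: module_hom scale scale N
    by (rule Vector_Spaces.linear.axioms(3)[OF linear])
  show ?thesis
  proof (intro ternary_nijenhuis_operator.intro ternary_nijenhuis_operator_axioms.intro)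
    show "ternary_leibniz_algebra scale (assoc_ternary br)"
      by (rule ternary_leibniz_algebra_assoc_ternary)
    show "Vector_Spaces.linear scale scale N"
      by (rule linear)
    fix x y z
    define p where "p = br (N y) z + br y (N z) - N (br y z)"
    have Np: "br (N y) (N z) = N p"
      unfolding p_def by (rule nijenhuis)
    have "br (N x) (br (N y) (N z)) = N (br (N x) p + br x (br (N y) (N z)) - N (br x p))"
      unfolding Np by (rule nijenhuis)
    moreover have "br (N x) (N (br y z)) =
        N (br (N x) (br y z) + br x (N (br y z)) - N (br x (br y z)))"
      by (rule nijenhuis)
    ultimately show "assoc_ternary br (N x) (N y) (N z) =
        N (assoc_ternary br (N x) (N y) z + assoc_ternary br (N x) y (N z)
           + assoc_ternary br x (N y) (N z))
        - N (N (assoc_ternary br (N x) y z + assoc_ternary br x (N y) z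
                + assoc_ternary br x y (N z)))
        + N (N (N (assoc_ternary br x y z)))"
      by (simp add: assoc_ternary_def p_def bracket_linear_right_simps N.add N.diff algebra_simps)
  qed
qed

theorem proposition2p11:
  fixes scale :: "'k::field \<Rightarrow> 'v::ab_group_add \<Rightarrow> 'v"
    and br :: "'v \<Rightarrow> 'v \<Rightarrow> 'v"
    and lam :: 'k
  assumes "leibniz_algebra scale br"
  shows "(\<forall>R. rota_baxter_operator scale br lam R
            \<longrightarrow> ternary_rota_baxter_operator scale (assoc_ternary br) lam R)
       \<and> (\<forall>N. nijenhuis_operator scale br N
            \<longrightarrow> ternary_nijenhuis_operator scale (assoc_ternary br) N)
       \<and> (\<forall>br\<^sub>1. compatible_leibniz_algebra scale br br\<^sub>1
            \<and> compatible_ternary_leibniz_algebra scale (assoc_ternary br) (assoc_ternary br\<^sub>1)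
            \<longrightarrow> (\<forall>R. rota_baxter_operator scale br lam R \<and> rota_baxter_operator scale br\<^sub>1 lam R
                  \<longrightarrow> compatible_ternary_rota_baxter_operator scale
                        (assoc_ternary br) (assoc_ternary br\<^sub>1) lam R)
              \<and> (\<forall>N. nijenhuis_operator scale br N \<and> nijenhuis_operator scale br\<^sub>1 N
                  \<longrightarrow> compatible_ternary_nijenhuis_operator scale
                        (assoc_ternary br) (assoc_ternary br\<^sub>1) N))"
  by (simp add: compatible_ternary_rota_baxter_operator_def
      compatible_ternary_nijenhuis_operator_def
      rota_baxter_operator.ternary_rota_baxter_operator_assoc_ternary
      nijenhuis_operator.ternary_nijenhuis_operator_assoc_ternary)

end
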